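(* Let $X$ be a real or complex Banach space with dual space $X^*$, let $A:\mathbb{N}\to\mathcal{B}(X)$ be a sequence, and consider the linear discrete-time system $x_{n+1}=A(n)x_n$ with associated operators $A_m^n$, $(m,n)\in\Delta$. The system is exponentially stable if and only if there exist constants $B\ge1$, $b>0$ and $c\in[0,b)$ such that $$\sum_{k=0}^{m}e^{b(m-k)}\|(A_m^k)^*x^*\|\le B e^{cm}\|x^*\|\quad\text{for all }m\in\mathbb{N}\text{ and }x^*\in X^*.$$
   Context: $\mathbb{N}=\{0,1,2,\dots\}$. $\mathcal{B}(X)$ is the Banach algebra of bounded linear operators on $X$, and $I$ is the identity operator. $\Delta$ is the set of pairs $(m,n)$ of nonnegative integers with $m\ge n$. $T$ is the set of triples $(m,n,p)$ of nonnegative integers with $(m,n)\in\Delta$ and $(n,p)\in\Delta$. For $(m,n)\in\Delta$, $A_m^n=A(m)A(m-1)\cdots A(n+1)$ if $m\ge n+1$, and $A_m^n=I$ if $m=n$. $X^*$ is the Banach space of continuous linear functionals on $X$, and $(A_m^k)^*:X^*\to X^*$ is the adjoint (dual) operator of $A_m^k$. The system is exponentially stable if there are constants $N\ge1$, $\alpha>0$ and $\beta\ge0$ such that $\|A_m^p x\|\le N e^{-\alpha(m-n)}e^{\beta n}\|A_n^p x\|$ for all $(m,n,p)\in T$ and $x\in X$. *)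

theory Defs
  imports "HOL-Analysis.Analysis"
begin

text \<open>
  A complex Banach space is represented by its underlying real Banach space, a type of class
  \<open>banach\<close>, together with a complex scalar multiplication that extends the real one and
  for which the norm is homogeneous.
\<close>

definition complex_normed_scaling :: "(complex \<Rightarrow> 'a::real_normed_vector \<Rightarrow> 'a) \<Rightarrow> bool" where
  "complex_normed_scaling cscale \<longleftrightarrow>
     vector_space cscale \<and>
     (\<forall>r x. cscale (of_real r) x = r *\<^sub>R x) \<and>
     (\<forall>c x. norm (cscale c x) = cmod c * norm x)"

text \<open>
  The type \<open>'a \<Rightarrow>\<^sub>L 'b\<close> only requires linearity over the reals; linearity over the complex
  scalars is added by restricting to the following sets. The norm is the operator norm in
  either case.
\<close>

definition complex_bounded_operators ::
    "(complex \<Rightarrow> 'a::real_normed_vector \<Rightarrow> 'a) \<Rightarrow> ('a \<Rightarrow>\<^sub>L 'a) set" where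
  "complex_bounded_operators cscale = {S. Vector_Spaces.linear cscale cscale (blinfun_apply S)}"

definition complex_dual ::
    "(complex \<Rightarrow> 'a::real_normed_vector \<Rightarrow> 'a) \<Rightarrow> ('a \<Rightarrow>\<^sub>L complex) set" where
  "complex_dual cscale = {f. Vector_Spaces.linear cscale (*) (blinfun_apply f)}"

text \<open>The adjoint of \<open>S\<close> acting on functionals with values in the scalar field \<open>'k\<close>.\<close>

definition dual_operator ::
    "('a::real_normed_vector \<Rightarrow>\<^sub>L 'a) \<Rightarrow> ('a \<Rightarrow>\<^sub>L 'k::real_normed_field) \<Rightarrow> ('a \<Rightarrow>\<^sub>L 'k)" where
  "dual_operator S f = f o\<^sub>L S"

text \<open>
  \<open>evolution A m n\<close> is \<open>A m o\<^sub>L \<dots> o\<^sub>L A (n + 1)\<close> for \<open>m > n\<close> and the identity for \<open>m = n\<close>.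
  It is only meaningful for \<open>n \<le> m\<close>; for \<open>m < n\<close> it is the identity by convention.
\<close>

primrec evolution ::
    "(nat \<Rightarrow> 'a::real_normed_vector \<Rightarrow>\<^sub>L 'a) \<Rightarrow> nat \<Rightarrow> nat \<Rightarrow> 'a \<Rightarrow>\<^sub>L 'a" where
  "evolution A 0 n = id_blinfun"
| "evolution A (Suc m) n =
     (if n \<le> m then A (Suc m) o\<^sub>L evolution A m n else id_blinfun)"

definition exponentially_stable :: "(nat \<Rightarrow> 'a::real_normed_vector \<Rightarrow>\<^sub>L 'a) \<Rightarrow> bool" where
  "exponentially_stable A \<longleftrightarrow>
     (\<exists>N \<alpha> \<beta>. N \<ge> 1 \<and> \<alpha> > 0 \<and> \<beta> \<ge> 0 \<and>
        (\<forall>m n p x. p \<le> n \<longrightarrow> n \<le> m \<longrightarrow>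
           norm (evolution A m p x)
             \<le> N * exp (- \<alpha> * (real m - real n)) * exp (\<beta> * real n) * norm (evolution A n p x)))"

end

theory Submission
  imports Defs
begin

text \<open>
  The cocycle identity reduces exponential stability to the operator bounds
  \<open>\<parallel>A\<^sub>m\<^sup>n\<parallel> \<le> N exp (- \<alpha> (m - n)) exp (\<beta> n)\<close>. Such bounds give the summability condition with
  \<open>b = \<alpha> + \<beta>\<close> and \<open>c = \<beta> + \<alpha> / 2\<close>, the slack \<open>\<alpha> / 2\<close> absorbing the number \<open>m + 1\<close> of
  summands. Conversely, a single summand bounds \<open>\<parallel>(A\<^sub>m\<^sup>k)\<^sup>* f\<parallel>\<close>, and the Hahn-Banach theorem turns
  this into a bound on \<open>\<parallel>A\<^sub>m\<^sup>k\<parallel>\<close> with \<open>\<alpha> = b - c\<close> and \<open>\<beta> = c\<close>.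
\<close>

subsection \<open>Norming functionals\<close>

text \<open>Values may be negative and scaling concerns nonnegative factors only, so linear
  functionals qualify along with norms. They turn out to be the minimal elements.\<close>

definition sublinear :: "('a::real_vector \<Rightarrow> real) \<Rightarrow> bool" where
  "sublinear p \<longleftrightarrow>
     (\<forall>x y. p (x + y) \<le> p x + p y) \<and> (\<forall>t x. 0 \<le> t \<longrightarrow> p (t *\<^sub>R x) = t * p x)"

lemma sublinear_add: "sublinear p \<Longrightarrow> p (x + y) \<le> p x + p y"
  and sublinear_scale: "sublinear p \<Longrightarrow> 0 \<le> t \<Longrightarrow> p (t *\<^sub>R x) = t * p x"
  by (auto simp: sublinear_def)

lemma sublinear_zero: "sublinear p \<Longrightarrow> p 0 = 0"
  using sublinear_scale[of p 0 0] by simp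

lemma sublinear_minus: "sublinear p \<Longrightarrow> - p (- x) \<le> p x"
  using sublinear_add[of p x "- x"] sublinear_zero[of p] by simp

text \<open>Infima yield one-sided estimates. One inequality for positive factors is enough, since
  applying it with \<open>inverse t\<close> to \<open>t *\<^sub>R x\<close> reverses it.\<close>

lemma sublinearI:
  assumes "\<And>x y. p (x + y) \<le> p x + p y"
    and "\<And>t x. 0 < t \<Longrightarrow> p (t *\<^sub>R x) \<le> t * p x"
    and "p 0 = 0"
  shows "sublinear p"
  unfolding sublinear_def
proof (intro conjI allI impI)
  fix t :: real and x assume "0 \<le> t"
  show "p (t *\<^sub>R x) = t * p x"
  proof (cases "t = 0")
    case False
    with \<open>0 \<le> t\<close> have t: "0 < t" by simp
    have "p x = p (inverse t *\<^sub>R (t *\<^sub>R x))" using t by simp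
    also have "\<dots> \<le> inverse t * p (t *\<^sub>R x)" using t by (intro assms(2)) simp
    finally have "t * p x \<le> p (t *\<^sub>R x)" using t by (simp add: field_simps)
    with assms(2)[OF t, of x] show ?thesis by simp
  qed (simp add: assms(3))
qed (rule assms(1))

lemma sublinear_norm: "sublinear (norm :: 'a::real_normed_vector \<Rightarrow> real)"
  by (simp add: sublinear_def norm_triangle_ineq)

text \<open>Replacing \<open>p\<close> by \<open>x \<mapsto> inf\<^sub>t p (x + t y) - t p y\<close> makes \<open>p\<close> linear in the direction \<open>y\<close>.\<close>

lemma sublinear_linearize_at:
  assumes p: "sublinear p"
  obtains q where "sublinear q" "\<And>x. q x \<le> p x" "q (- y) \<le> - p y"
proof
  define S where "S x = (\<lambda>t. p (x + t *\<^sub>R y) - t * p y) ` {0..}" for x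
  define q where "q x = Inf (S x)" for x
  \<comment> \<open>This bound is independent of \<open>t\<close>, so the infimum is finite. It
    comes from writing \<open>t *\<^sub>R y\<close> as the sum of \<open>x + t *\<^sub>R y\<close>
    and \<open>- x\<close>.\<close>
  have lower: "- p (- x) \<le> p (x + t *\<^sub>R y) - t * p y" if "0 \<le> t" for x t
    using sublinear_add[OF p, of "x + t *\<^sub>R y" "- x"] sublinear_scale[OF p that, of y] by simp
  have bdd: "bdd_below (S x)" for x
    unfolding S_def by (rule bdd_belowI[of _ "- p (- x)"]) (auto intro: lower)
  have ne: "S x \<noteq> {}" for x by (auto simp: S_def)
  have q_le: "q x \<le> p (x + t *\<^sub>R y) - t * p y" if "0 \<le> t" for x t
    unfolding q_def by (rule cInf_lower[OF _ bdd]) (use that in \<open>auto simp: S_def\<close>)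
  have q_ge: "c \<le> q x" if "\<And>t. 0 \<le> t \<Longrightarrow> c \<le> p (x + t *\<^sub>R y) - t * p y" for c x
    unfolding q_def by (rule cInf_greatest[OF ne]) (use that in \<open>auto simp: S_def\<close>)
  show "q x \<le> p x" for x using q_le[of 0 x] by simp
  \<comment> \<open>The shift \<open>t = 1\<close> moves \<open>- y\<close> to the origin, where
    \<open>p\<close> vanishes.\<close>
  show "q (- y) \<le> - p y" using q_le[of 1 "- y"] sublinear_zero[OF p] by simp
  show "sublinear q"
  proof (rule sublinearI)
    fix x z
    have sum: "q (x + z) \<le> (p (x + s *\<^sub>R y) - s * p y) + (p (z + t *\<^sub>R y) - t * p y)"
      if "0 \<le> s" "0 \<le> t" for s t
      using q_le[of "s + t" "x + z"] that sublinear_add[OF p, of "x + s *\<^sub>R y" "z + t *\<^sub>R y"]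
      by (simp add: algebra_simps)
    \<comment> \<open>The two infima are taken one at a time: over the shift of \<open>z\<close>
      with \<open>s\<close> fixed, then over \<open>s\<close>.\<close>
    have "q (x + z) - q z \<le> p (x + s *\<^sub>R y) - s * p y" if s: "0 \<le> s" for s
    proof -
      have "q (x + z) - (p (x + s *\<^sub>R y) - s * p y) \<le> q z"
        by (rule q_ge) (use sum[OF s] in \<open>simp add: algebra_simps\<close>)
      then show ?thesis by simp
    qed
    from q_ge[OF this] show "q (x + z) \<le> q x + q z" by simp
  next
    fix t :: real and x assume t: "0 < t"
    have "inverse t * q (t *\<^sub>R x) \<le> q x"
    proof (rule q_ge)
      fix s :: real assume s: "0 \<le> s"
      \<comment> \<open>Shifting \<open>x\<close> by \<open>s\<close> corresponds to shifting
        \<open>t *\<^sub>R x\<close> by \<open>t * s\<close>.\<close>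
      have "q (t *\<^sub>R x) \<le> p (t *\<^sub>R x + (t * s) *\<^sub>R y) - t * s * p y"
        using t s by (intro q_le) simp
      also have "t *\<^sub>R x + (t * s) *\<^sub>R y = t *\<^sub>R (x + s *\<^sub>R y)" by (simp add: algebra_simps)
      also have "p \<dots> = t * p (x + s *\<^sub>R y)" using t by (simp add: sublinear_scale[OF p])
      finally show "inverse t * q (t *\<^sub>R x) \<le> p (x + s *\<^sub>R y) - s * p y"
        using t by (simp add: field_simps)
    qed
    then show "q (t *\<^sub>R x) \<le> t * q x" using t by (simp add: field_simps)
  next
    show "q 0 = 0"
      using q_le[of 0 0] q_ge[of 0 0] sublinear_zero[OF p] sublinear_scale[OF p] by force
  qed
qed

text \<open>An infimum of sublinear functionals can fail to be subadditive. In a chain, the smaller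
  of two members serves for both summands. The common bound \<open>r\<close> keeps the infimum
  finite through \<open>- r (- x) \<le> - p (- x) \<le> p x\<close>.\<close>

lemma sublinear_Inf_chain:
  fixes C :: "('a::real_vector \<Rightarrow> real) set"
  assumes sub: "\<And>p. p \<in> C \<Longrightarrow> sublinear p" and le: "\<And>p x. p \<in> C \<Longrightarrow> p x \<le> r x"
    and chain: "\<And>p q. p \<in> C \<Longrightarrow> q \<in> C \<Longrightarrow> p \<le> q \<or> q \<le> p" and ne: "C \<noteq> {}"
  shows "sublinear (\<lambda>x. INF p\<in>C. p x)" "p \<in> C \<Longrightarrow> (INF p\<in>C. p x) \<le> p x"
proof -
  have "bdd_below ((\<lambda>p. p x) ` C)" for x
  proof (rule bdd_belowI2)
    fix p assume "p \<in> C"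
    with sublinear_minus[OF sub, of p x] le[of p "- x"] show "- r (- x) \<le> p x" by simp
  qed
  then have lower: "(INF p\<in>C. p x) \<le> p x" if "p \<in> C" for p x
    using that by (rule cINF_lower)
  then show "p \<in> C \<Longrightarrow> (INF p\<in>C. p x) \<le> p x" .
  show "sublinear (\<lambda>x. INF p\<in>C. p x)"
  proof (rule sublinearI)
    fix x y
    have pq: "(INF p\<in>C. p (x + y)) \<le> p x + q y" if pC: "p \<in> C" and qC: "q \<in> C" for p q
      using chain[OF pC qC]
    proof
      assume "p \<le> q"
      then show ?thesis
        using lower[OF pC, of "x + y"] sublinear_add[OF sub[OF pC], of x y] le_funD[of p q y]
        by simp
    next
      assume "q \<le> p"
      then show ?thesis
        using lower[OF qC, of "x + y"] sublinear_add[OF sub[OF qC], of x y] le_funD[of q p x]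
        by simp
    qed
    have "(INF p\<in>C. p (x + y)) - (INF q\<in>C. q y) \<le> (INF p\<in>C. p x)"
    proof (rule cINF_greatest[OF ne])
      fix p assume p: "p \<in> C"
      have "(INF p\<in>C. p (x + y)) - p x \<le> (INF q\<in>C. q y)"
        by (rule cINF_greatest[OF ne]) (use pq[OF p] in \<open>simp add: algebra_simps\<close>)
      then show "(INF p\<in>C. p (x + y)) - (INF q\<in>C. q y) \<le> p x" by simp
    qed
    then show "(INF p\<in>C. p (x + y)) \<le> (INF p\<in>C. p x) + (INF p\<in>C. p y)" by simp
  next
    fix t :: real and x assume t: "0 < t"
    have "inverse t * (INF p\<in>C. p (t *\<^sub>R x)) \<le> (INF p\<in>C. p x)"
    proof (rule cINF_greatest[OF ne])
      fix p assume p: "p \<in> C"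
      show "inverse t * (INF p\<in>C. p (t *\<^sub>R x)) \<le> p x"
        using lower[OF p, of "t *\<^sub>R x"] sublinear_scale[OF sub[OF p], of t x] t
        by (simp add: field_simps)
    qed
    then show "(INF p\<in>C. p (t *\<^sub>R x)) \<le> t * (INF p\<in>C. p x)" using t by (simp add: field_simps)
  next
    have "(\<lambda>p. p 0) ` C = {0}" using ne by (auto simp: sublinear_zero sub)
    then show "(INF p\<in>C. p 0) = 0" by simp
  qed
qed

text \<open>Zorn's lemma gives a minimal sublinear functional below \<open>p\<close>; minimality makes it linear.\<close>

lemma sublinear_dominates_linear:
  fixes p :: "'a::real_vector \<Rightarrow> real"
  assumes p: "sublinear p"
  obtains f where "linear f" "\<And>x. f x \<le> p x"
proof -
  define S where "S = {q. sublinear q \<and> q \<le> p}"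
  \<comment> \<open>The order is reversed: maximal elements are minimal functionals, and the
    pointwise infimum bounds a nonempty chain.\<close>
  have "\<exists>f\<in>S. \<forall>q\<in>S. f \<ge> q \<longrightarrow> q = f"
  proof (rule predicate_Zorn)
    show "partial_order_on S (relation_of (\<ge>) S)"
      by (rule partial_order_on_relation_ofI) auto
    fix C assume C: "C \<in> Chains (relation_of (\<ge>) S)"
    then have CS: "C \<subseteq> S" by (rule Chains_relation_of)
    show "\<exists>u\<in>S. \<forall>q\<in>C. q \<ge> u"
    proof (cases "C = {}")
      case True
      with p show ?thesis by (auto simp: S_def)
    next
      case False
      have sub: "sublinear q" and le: "q x \<le> p x" if "q \<in> C" for q x
        using that CS by (auto simp: S_def le_fun_def)
      have chain: "q \<le> r \<or> r \<le> q" if "q \<in> C" "r \<in> C" for q r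
        using that C by (auto simp: Chains_def relation_of_def)
      have inf: "sublinear (\<lambda>x. INF q\<in>C. q x)" "\<And>q x. q \<in> C \<Longrightarrow> (INF q\<in>C. q x) \<le> q x"
        using sublinear_Inf_chain[of C p] sub le chain False by blast+
      from False obtain r where r: "r \<in> C" by blast
      have "(\<lambda>x. INF q\<in>C. q x) \<in> S"
        using inf(1) order_trans[OF inf(2)[OF r] le[OF r]] by (simp add: S_def le_fun_def)
      then show ?thesis using inf(2) by (intro bexI[of _ "\<lambda>x. INF q\<in>C. q x"]) (auto simp: le_fun_def)
    qed
  qed
  \<comment> \<open>Membership in \<open>S\<close> is dropped from the minimality clause, since
    anything below \<open>f\<close> is below \<open>p\<close>.\<close>
  then obtain f where f: "sublinear f" "f \<le> p" and min: "\<And>q. sublinear q \<Longrightarrow> q \<le> f \<Longrightarrow> q = f"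
    by (auto simp: S_def dest: order_trans)
  \<comment> \<open>Linearizing \<open>f\<close> at \<open>y\<close> cannot lower it, by minimality.
    So \<open>f (- y) \<le> - f y\<close>, and the reverse holds for every sublinear
    functional.\<close>
  have neg: "f (- y) = - f y" for y
  proof -
    obtain q where q: "sublinear q" "\<And>x. q x \<le> f x" "q (- y) \<le> - f y"
      using sublinear_linearize_at[OF f(1), of y] by blast
    have "q = f" using q by (intro min) (auto simp: le_fun_def)
    with q(3) sublinear_minus[OF f(1), of y] show ?thesis by simp
  qed
  have "linear f"
  proof (rule linearI)
    fix x y
    \<comment> \<open>Subadditivity at \<open>- x\<close> and \<open>- y\<close>, combined with
      oddness, is superadditivity at \<open>x\<close> and \<open>y\<close>.\<close>
    show "f (x + y) = f x + f y"
      using sublinear_add[OF f(1), of x y] sublinear_add[OF f(1), of "- x" "- y"] neg[of "x + y"]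
      by (simp add: neg)
  next
    fix t :: real and x
    show "f (t *\<^sub>R x) = t *\<^sub>R f x"
    proof (cases "0 \<le> t")
      case False
      then show ?thesis
        using sublinear_scale[OF f(1), of "- t" x] neg[of "t *\<^sub>R x"] by simp
    qed (simp add: sublinear_scale[OF f(1)])
  qed
  with f(2) show thesis by (intro that) (auto simp: le_fun_def)
qed

section \<open>Hahn-Banach over the real and the complex scalars\<close>

lemma real_norming_functional:
  fixes y :: "'a::real_normed_vector"
  obtains f where "linear f" "\<And>x. \<bar>f x\<bar> \<le> norm x" "f y = norm y"
proof -
  \<comment> \<open>The norm is linearized at \<open>y\<close> before a linear minorant is chosen.
    Every linear \<open>f\<close> below \<open>q\<close> then satisfies
    \<open>f (- y) \<le> - norm y\<close>, which forces \<open>f y = norm y\<close>.\<close>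
  obtain q where q: "sublinear q" "\<And>x::'a. q x \<le> norm x" "q (- y) \<le> - norm y"
    using sublinear_linearize_at[OF sublinear_norm, of y] by blast
  obtain f where f: "linear f" "\<And>x. f x \<le> q x"
    using sublinear_dominates_linear[OF q(1)] by blast
  have le: "f x \<le> norm x" for x using order_trans[OF f(2) q(2)] .
  have "\<bar>f x\<bar> \<le> norm x" for x
    using le[of x] le[of "- x"] linear_neg[OF f(1), of x] by (simp add: abs_le_iff)
  moreover have "f y = norm y"
    using le[of y] order_trans[OF f(2) q(3)] linear_neg[OF f(1), of y] by simp
  ultimately show thesis using that f(1) by blast
qed

text \<open>The form \<open>norm f \<le> 1\<close>, rather than equality, also covers the zero
  space.\<close>

lemma dual_norming_functional:
  fixes y :: "'a::real_normed_vector"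
  obtains f :: "'a \<Rightarrow>\<^sub>L real" where "norm f \<le> 1" "norm y \<le> norm (blinfun_apply f y)"
proof -
  obtain g where g: "linear g" "\<And>x::'a. \<bar>g x\<bar> \<le> norm x" "g y = norm y"
    using real_norming_functional[of y] by blast
  have "bounded_linear g"
    using g by (intro bounded_linear_intro[of _ 1]) (auto simp: linear_add linear_cmul)
  then have ap: "blinfun_apply (Blinfun g) = g" by (rule bounded_linear_Blinfun_apply)
  show thesis
    by (rule that[of "Blinfun g"]) (auto intro!: norm_blinfun_bound simp: ap g)
qed

text \<open>The Bohnenblust-Sobczyk argument: a complex-linear functional is determined by its real
  part \<open>u\<close> through \<open>u x - \<i> * u (\<i> x)\<close>, so a real norming functional
  is complexified.\<close>

lemma complex_dual_norming_functional:
  fixes y :: "'a::real_normed_vector"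
  assumes cs: "complex_normed_scaling cscale"
  obtains f where "f \<in> complex_dual cscale" "norm f \<le> 1" "norm y \<le> norm (blinfun_apply f y)"
proof -
  have vs: "vector_space cscale" and of_real: "cscale (of_real r) x = r *\<^sub>R x"
    and norm_cscale: "norm (cscale c x) = cmod c * norm x" for r c x
    using cs by (auto simp: complex_normed_scaling_def)
  interpret V: vector_space cscale by (rule vs)
  obtain u where u: "linear u" "\<And>x::'a. \<bar>u x\<bar> \<le> norm x" "u y = norm y"
    using real_norming_functional[of y] by blast
  define g where "g x = Complex (u x) (- u (cscale \<i> x))" for x
  have ii: "cscale \<i> (cscale \<i> x) = - x" for x
    using of_real[of "-1" x] by simp
  \<comment> \<open>Complex scaling is reduced to real scaling and multiplication by
    \<open>\<i>\<close>, so that real linearity of \<open>u\<close> and \<open>ii\<close> give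
    complex homogeneity of \<open>g\<close>.\<close>
  have cscale: "cscale c x = Re c *\<^sub>R x + Im c *\<^sub>R cscale \<i> x" for c x
  proof -
    have "c = of_real (Re c) + of_real (Im c) * \<i>" by (simp add: complex_eq_iff)
    then have "cscale c x = cscale (of_real (Re c)) x + cscale (of_real (Im c)) (cscale \<i> x)"
      by (metis V.scale_left_distrib V.scale_scale)
    then show ?thesis by (simp only: of_real)
  qed
  have cadd: "cscale c (x + z) = cscale c x + cscale c z" for c x z
    by (rule V.scale_right_distrib)
  have cscaleR: "cscale c (r *\<^sub>R x) = r *\<^sub>R cscale c x" for c r x
    by (metis V.scale_left_commute of_real)
  have g_add: "g (x + z) = g x + g z" for x z
    by (simp add: g_def complex_eq_iff linear_add[OF u(1)] cadd)
  have g_scale: "g (cscale c x) = c * g x" for c x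
    by (simp add: g_def complex_eq_iff cscale[of c] linear_add[OF u(1)] linear_cmul[OF u(1)]
        linear_neg[OF u(1)] linear_diff[OF u(1)] cadd cscaleR ii algebra_simps)
  have g_scaleR: "g (r *\<^sub>R x) = r *\<^sub>R g x" for r x
    using g_scale[of "of_real r" x] by (simp add: of_real scaleR_conv_of_real)
  have lin: "Vector_Spaces.linear cscale (*) g"
    by (rule Vector_Spaces.linear.intro)
      (use vs g_add g_scale in \<open>auto simp: module_hom_def module_hom_axioms_def
        vector_space_def module_def algebra_simps\<close>)
  \<comment> \<open>Rotating \<open>x\<close> so that \<open>g x\<close> becomes real reduces the bound on \<open>g\<close> to the one on \<open>u\<close>.\<close>
  have g_le: "cmod (g x) \<le> norm x" for x
  proof (cases "g x = 0")
    case False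
    define c where "c = cnj (sgn (g x))"
    have c: "cmod c = 1" using False by (simp add: c_def norm_sgn)
    have "c * g x = of_real (cmod (g x))"
      using False by (simp add: c_def sgn_eq complex_norm_square[symmetric] power2_eq_square
          mult.commute[of "cnj _"])
    then have "cmod (g x) = Re (g (cscale c x))" by (simp add: g_scale)
    also have "\<dots> = u (cscale c x)" by (simp add: g_def)
    also have "\<dots> \<le> norm (cscale c x)" using u(2)[of "cscale c x"] by simp
    also have "\<dots> = norm x" by (simp add: norm_cscale c)
    finally show ?thesis .
  qed simp
  have "bounded_linear g"
    using g_add g_scaleR g_le by (intro bounded_linear_intro[of _ 1]) auto
  then have ap: "blinfun_apply (Blinfun g) = g" by (rule bounded_linear_Blinfun_apply)
  show thesis
  proof (rule that)
    show "Blinfun g \<in> complex_dual cscale" by (simp add: complex_dual_def ap lin)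
    show "norm (Blinfun g) \<le> 1" by (auto intro!: norm_blinfun_bound simp: ap g_le)
    have "norm y = \<bar>Re (g y)\<bar>" by (simp add: g_def u(3))
    also have "\<dots> \<le> norm (Blinfun g y)" unfolding ap by (rule abs_Re_le_cmod)
    finally show "norm y \<le> norm (Blinfun g y)" .
  qed
qed

subsection \<open>Stability and the dual system\<close>

lemma id_blinfun_compose: "id_blinfun o\<^sub>L S = S"
  by (rule blinfun_eqI) simp

lemma evolution_same: "evolution A m m = id_blinfun"
  by (cases m) auto

lemma evolution_trans:
  assumes "p \<le> n" "n \<le> m"
  shows "evolution A m p = evolution A m n o\<^sub>L evolution A n p"
  using \<open>n \<le> m\<close>
proof (induction rule: dec_induct)
  case base
  then show ?case by (simp add: evolution_same id_blinfun_compose)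
next
  case (step m)
  then show ?case using \<open>p \<le> n\<close> by (auto intro: blinfun_eqI)
qed

text \<open>The same constants work on both sides. The case \<open>p = n\<close> gives the operator
  bound, and factoring through time \<open>n\<close> gives the converse.\<close>

lemma exponentially_stable_iff_norm_bound:
  "exponentially_stable A \<longleftrightarrow>
     (\<exists>N \<alpha> \<beta>. N \<ge> 1 \<and> \<alpha> > 0 \<and> \<beta> \<ge> 0 \<and>
        (\<forall>m n. n \<le> m \<longrightarrow>
           norm (evolution A m n) \<le> N * exp (- \<alpha> * (real m - real n)) * exp (\<beta> * real n)))"
  unfolding exponentially_stable_def
proof (intro ex_cong1 conj_cong refl iffI allI impI)
  fix N \<alpha> \<beta> :: real and m n :: nat
  assume "1 \<le> N" and bound: "\<forall>m n p x. p \<le> n \<longrightarrow> n \<le> m \<longrightarrow> norm (evolution A m p x)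
      \<le> N * exp (- \<alpha> * (real m - real n)) * exp (\<beta> * real n) * norm (evolution A n p x)"
    and "n \<le> m"
  show "norm (evolution A m n) \<le> N * exp (- \<alpha> * (real m - real n)) * exp (\<beta> * real n)"
  proof (rule norm_blinfun_bound)
    show "norm (evolution A m n x)
        \<le> N * exp (- \<alpha> * (real m - real n)) * exp (\<beta> * real n) * norm x" for x
      using bound[rule_format, of n n m x] \<open>n \<le> m\<close> by (simp add: evolution_same)
  qed (use \<open>1 \<le> N\<close> in simp)
next
  fix N \<alpha> \<beta> :: real and m n p :: nat and x
  assume bound: "\<forall>m n. n \<le> m \<longrightarrow>
      norm (evolution A m n) \<le> N * exp (- \<alpha> * (real m - real n)) * exp (\<beta> * real n)"
    and "p \<le> n" "n \<le> m"
  have "norm (evolution A m p x) \<le> norm (evolution A m n) * norm (evolution A n p x)"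
    by (simp add: evolution_trans[OF \<open>p \<le> n\<close> \<open>n \<le> m\<close>] norm_blinfun)
  also have "\<dots> \<le> N * exp (- \<alpha> * (real m - real n)) * exp (\<beta> * real n) * norm (evolution A n p x)"
    using bound \<open>n \<le> m\<close> by (intro mult_right_mono) auto
  finally show "norm (evolution A m p x)
      \<le> N * exp (- \<alpha> * (real m - real n)) * exp (\<beta> * real n) * norm (evolution A n p x)" .
qed

lemma norm_dual_operator_le: "norm (dual_operator S f) \<le> norm S * norm f"
  using norm_blinfun_compose[of f S] by (simp add: dual_operator_def mult.commute)

text \<open>Each vector \<open>S x\<close> is tested against a functional of \<open>D\<close> that
  norms it. Keeping \<open>D\<close> general serves the real and the complex dual alike.\<close>

lemma norm_le_of_dual_operator_bound:
  fixes D :: "('a::real_normed_vector \<Rightarrow>\<^sub>L 'k::real_normed_field) set"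
  assumes norming: "\<And>y. \<exists>f\<in>D. norm f \<le> 1 \<and> norm y \<le> norm (blinfun_apply f y)"
    and "0 \<le> K" and bound: "\<And>f. f \<in> D \<Longrightarrow> norm (dual_operator S f) \<le> K * norm f"
  shows "norm S \<le> K"
proof (rule norm_blinfun_bound[OF \<open>0 \<le> K\<close>])
  fix x
  obtain f where f: "f \<in> D" "norm f \<le> 1" "norm (S x) \<le> norm (f (S x))"
    using norming by blast
  note f(3)
  also have "norm (f (S x)) = norm (dual_operator S f x)" by (simp add: dual_operator_def)
  also have "\<dots> \<le> norm (dual_operator S f) * norm x" by (rule norm_blinfun)
  also have "norm (dual_operator S f) \<le> K * 1"
    using bound[OF f(1)] mult_left_mono[OF f(2) \<open>0 \<le> K\<close>] by linarith
  finally show "norm (S x) \<le> K * norm x" by (simp add: mult_right_mono)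
qed

text \<open>The product \<open>(1 + 1 / a) * (1 + a * m)\<close> expands to
  \<open>m + 1 + a * m + 1 / a\<close>, and \<open>1 + t \<le> exp t\<close> finishes the
  estimate.\<close>

lemma Suc_le_exp:
  fixes a :: real
  assumes "0 < a"
  shows "real m + 1 \<le> (1 + 1 / a) * exp (a * real m)"
proof -
  have "real m + 1 \<le> (1 + 1 / a) * (1 + a * real m)"
    using assms by (simp add: field_simps)
  also have "\<dots> \<le> (1 + 1 / a) * exp (a * real m)"
    using assms by (intro mult_left_mono exp_ge_add_one_self) auto
  finally show ?thesis .
qed

lemma exponentially_stable_iff_dual:
  fixes A :: "nat \<Rightarrow> 'a::real_normed_vector \<Rightarrow>\<^sub>L 'a"
    and D :: "('a \<Rightarrow>\<^sub>L 'k::real_normed_field) set"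
  assumes norming: "\<And>y. \<exists>f\<in>D. norm f \<le> 1 \<and> norm y \<le> norm (blinfun_apply f y)"
  shows "exponentially_stable A \<longleftrightarrow>
    (\<exists>B b c. B \<ge> 1 \<and> b > 0 \<and> 0 \<le> c \<and> c < b \<and>
      (\<forall>m. \<forall>f\<in>D.
         (\<Sum>k=0..m. exp (b * (real m - real k)) * norm (dual_operator (evolution A m k) f))
           \<le> B * exp (c * real m) * norm f))"
    (is "_ = ?dual")
proof
  assume "exponentially_stable A"
  then obtain N \<alpha> \<beta> where N: "N \<ge> 1" and \<alpha>: "\<alpha> > 0" and \<beta>: "\<beta> \<ge> 0"
    and bound: "\<And>m n. n \<le> m \<Longrightarrow>
      norm (evolution A m n) \<le> N * exp (- \<alpha> * (real m - real n)) * exp (\<beta> * real n)"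
    unfolding exponentially_stable_iff_norm_bound by blast
  \<comment> \<open>The second factor is the constant of \<open>Suc_le_exp\<close> at
    \<open>a = \<alpha> / 2\<close>.\<close>
  define B where "B = N * (1 + 1 / (\<alpha> / 2))"
  have "B \<ge> 1 * 1" unfolding B_def using N \<alpha> by (intro mult_mono) auto
  moreover have "(\<Sum>k=0..m. exp ((\<alpha> + \<beta>) * (real m - real k)) *
        norm (dual_operator (evolution A m k) f)) \<le> B * exp ((\<beta> + \<alpha> / 2) * real m) * norm f" for m f
  proof -
    \<comment> \<open>With weight \<open>\<alpha> + \<beta>\<close> the exponents add up to
      \<open>\<beta> * m\<close>, so the bound is the same for all \<open>k\<close>.\<close>
    have "exp ((\<alpha> + \<beta>) * (real m - real k)) * norm (dual_operator (evolution A m k) f)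
        \<le> N * exp (\<beta> * real m) * norm f" if "k \<in> {0..m}" for k
    proof -
      have "norm (dual_operator (evolution A m k) f)
          \<le> N * exp (- \<alpha> * (real m - real k)) * exp (\<beta> * real k) * norm f"
        using that by (intro order_trans[OF norm_dual_operator_le] mult_right_mono bound) auto
      then have "exp ((\<alpha> + \<beta>) * (real m - real k)) * norm (dual_operator (evolution A m k) f)
          \<le> exp ((\<alpha> + \<beta>) * (real m - real k)) *
            (N * exp (- \<alpha> * (real m - real k)) * exp (\<beta> * real k) * norm f)"
        by (intro mult_left_mono) auto
      also have "\<dots> = N * (exp ((\<alpha> + \<beta>) * (real m - real k)) *
            exp (- \<alpha> * (real m - real k)) * exp (\<beta> * real k)) * norm f"
        by simp
      also have "\<dots> = N * exp (\<beta> * real m) * norm f"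
        by (simp add: exp_add[symmetric] algebra_simps)
      finally show ?thesis .
    qed
    then have "(\<Sum>k=0..m. exp ((\<alpha> + \<beta>) * (real m - real k)) *
        norm (dual_operator (evolution A m k) f)) \<le> (\<Sum>k=0..m. N * exp (\<beta> * real m) * norm f)"
      by (rule sum_mono)
    also have "\<dots> = (real m + 1) * (N * exp (\<beta> * real m) * norm f)" by simp
    also have "\<dots> \<le> (1 + 1 / (\<alpha> / 2)) * exp (\<alpha> / 2 * real m) * (N * exp (\<beta> * real m) * norm f)"
      using N \<alpha> by (intro mult_right_mono Suc_le_exp) auto
    also have "\<dots> = B * exp ((\<beta> + \<alpha> / 2) * real m) * norm f"
      by (simp add: B_def ring_distribs exp_add)
    finally show ?thesis .
  qed
  ultimately show ?dual
    using \<alpha> \<beta> by (intro exI[of _ B] exI[of _ "\<alpha> + \<beta>"] exI[of _ "\<beta> + \<alpha> / 2"]) auto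
next
  assume ?dual
  then obtain B b c where B: "B \<ge> 1" and c: "0 \<le> c" "c < b"
    and sum: "\<And>m f. f \<in> D \<Longrightarrow>
      (\<Sum>k=0..m. exp (b * (real m - real k)) * norm (dual_operator (evolution A m k) f))
        \<le> B * exp (c * real m) * norm f"
    by blast
  have "norm (evolution A m k) \<le> B * exp (- (b - c) * (real m - real k)) * exp (c * real k)"
    if "k \<le> m" for m k
  proof (rule norm_le_of_dual_operator_bound[OF norming])
    fix f assume f: "f \<in> D"
    \<comment> \<open>All summands are nonnegative, so the one at \<open>k\<close> is at most the
      sum.\<close>
    have "exp (b * (real m - real k)) * norm (dual_operator (evolution A m k) f)
        \<le> (\<Sum>k=0..m. exp (b * (real m - real k)) * norm (dual_operator (evolution A m k) f))"
      using that by (intro member_le_sum) auto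
    also have "\<dots> \<le> B * exp (c * real m) * norm f" using f by (rule sum)
    finally have "exp (- (b * (real m - real k))) *
          (exp (b * (real m - real k)) * norm (dual_operator (evolution A m k) f))
        \<le> exp (- (b * (real m - real k))) * (B * exp (c * real m) * norm f)"
      by (rule mult_left_mono) simp
    then have "norm (dual_operator (evolution A m k) f)
        \<le> exp (- (b * (real m - real k))) * (B * exp (c * real m) * norm f)"
      by (simp add: mult.assoc[symmetric] exp_add[symmetric])
    also have "\<dots> = B * (exp (- (b * (real m - real k))) * exp (c * real m)) * norm f" by simp
    \<comment> \<open>Splitting \<open>c * m\<close> as \<open>c * (m - k) + c * k\<close> lowers
      the decay rate to \<open>b - c\<close> and leaves the growth \<open>c * k\<close>.\<close>
    also have "exp (- (b * (real m - real k))) * exp (c * real m)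
        = exp (- (b - c) * (real m - real k)) * exp (c * real k)"
      by (simp add: exp_add[symmetric] algebra_simps)
    finally show "norm (dual_operator (evolution A m k) f)
        \<le> B * exp (- (b - c) * (real m - real k)) * exp (c * real k) * norm f"
      by (simp add: mult.assoc)
  qed (use B in simp)
  then show "exponentially_stable A"
    unfolding exponentially_stable_iff_norm_bound
    using B c by (intro exI[of _ B] exI[of _ "b - c"] exI[of _ c]) auto
qed

theorem theorem8:
  fixes A :: "nat \<Rightarrow> 'a::banach \<Rightarrow>\<^sub>L 'a"
    and cscale :: "complex \<Rightarrow> 'b::banach \<Rightarrow> 'b"
    and C :: "nat \<Rightarrow> 'b \<Rightarrow>\<^sub>L 'b"
  shows
    "(exponentially_stable A \<longleftrightarrow>
        (\<exists>B b c. B \<ge> 1 \<and> b > 0 \<and> 0 \<le> c \<and> c < b \<and>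
          (\<forall>m. \<forall>f :: 'a \<Rightarrow>\<^sub>L real.
             (\<Sum>k=0..m. exp (b * (real m - real k)) * norm (dual_operator (evolution A m k) f))
               \<le> B * exp (c * real m) * norm f)))
     \<and>
     (complex_normed_scaling cscale \<longrightarrow>
      (\<forall>n. C n \<in> complex_bounded_operators cscale) \<longrightarrow>
      (exponentially_stable C \<longleftrightarrow>
        (\<exists>B b c. B \<ge> 1 \<and> b > 0 \<and> 0 \<le> c \<and> c < b \<and>
          (\<forall>m. \<forall>f \<in> complex_dual cscale.
             (\<Sum>k=0..m. exp (b * (real m - real k)) * norm (dual_operator (evolution C m k) f))
               \<le> B * exp (c * real m) * norm f))))"
proof (intro conjI impI)
  \<comment> \<open>Over the reals the norming set is the whole dual.\<close>
  have "\<exists>f\<in>UNIV :: ('a \<Rightarrow>\<^sub>L real) set. norm f \<le> 1 \<and> norm y \<le> norm (blinfun_apply f y)" for y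
    by (rule dual_norming_functional[of y]) auto
  from exponentially_stable_iff_dual[OF this]
  show "exponentially_stable A \<longleftrightarrow> (\<exists>B b c. B \<ge> 1 \<and> b > 0 \<and> 0 \<le> c \<and> c < b \<and>
      (\<forall>m. \<forall>f :: 'a \<Rightarrow>\<^sub>L real.
        (\<Sum>k=0..m. exp (b * (real m - real k)) * norm (dual_operator (evolution A m k) f))
          \<le> B * exp (c * real m) * norm f))"
    by simp
next
  assume "complex_normed_scaling cscale"
  \<comment> \<open>Over the complex numbers the norming set consists of the complex-linear
    functionals.\<close>
  then have "\<exists>f\<in>complex_dual cscale. norm f \<le> 1 \<and> norm y \<le> norm (blinfun_apply f y)" for y
    by (rule complex_dual_norming_functional[of _ y]) auto
  then show "exponentially_stable C \<longleftrightarrow> (\<exists>B b c. B \<ge> 1 \<and> b > 0 \<and> 0 \<le> c \<and> c < b \<and>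
      (\<forall>m. \<forall>f \<in> complex_dual cscale.
        (\<Sum>k=0..m. exp (b * (real m - real k)) * norm (dual_operator (evolution C m k) f))
          \<le> B * exp (c * real m) * norm f))"
    by (rule exponentially_stable_iff_dual)
qed

end
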